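(* Let $b>0$ be a real number. The rectangle $1\times b$ admits a gluing (on both sides, in one layer) by equal squares if and only if $b = p \pm \sqrt{p^2 - r^2}$ for some rational numbers $p \geq r \geq 0$.
   Context: Fix Cartesian coordinates in the plane. The lattice generated by the rectangle $1\times b$ is $\Lambda=\{(mb,n): m,n\in\mathbb{Z}\}$. Two points of the plane are called equivalent if one can be mapped to the other by a composition of central symmetries (point reflections) with respect to points of $\Lambda$. A gluing (on both sides, in one layer) of the rectangle $1\times b$ by equal squares is a finite set $G$ of congruent closed squares in the plane (of arbitrary orientation), pairwise having no common interior points, such that: (i) every point of the plane is equivalent to some point of the union of the squares of $G$; (ii) no two distinct points of the interior of the union of the squares of $G$ are equivalent. *)

theory Defs
  imports "HOL-Analysis.Analysis"
begin

type_synonym plane = "real \<times> real"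

definition rect_lattice :: "real \<Rightarrow> plane set" where
  "rect_lattice b = {(of_int m * b, of_int n) | m n :: int. True}"

definition point_reflection :: "plane \<Rightarrow> plane \<Rightarrow> plane" where
  "point_reflection c x = 2 *\<^sub>R c - x"

definition equivalent_points :: "real \<Rightarrow> plane \<Rightarrow> plane \<Rightarrow> bool" where
  "equivalent_points b x y \<longleftrightarrow>
     (\<exists>cs. set cs \<subseteq> rect_lattice b \<and> y = fold point_reflection cs x)"

definition congruent_sets :: "plane set \<Rightarrow> plane set \<Rightarrow> bool" where
  "congruent_sets S T \<longleftrightarrow>
     (\<exists>f :: plane \<Rightarrow> plane. (\<forall>x y. dist (f x) (f y) = dist x y) \<and> f ` S = T)"

(* Nondegenerate closed square with vertex a and orthogonal sides u, v, in any orientation.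
   The norm and inner product on real \<times> real are the Euclidean ones. *)
definition is_square :: "plane set \<Rightarrow> bool" where
  "is_square Q \<longleftrightarrow>
     (\<exists>a u v. u \<noteq> 0 \<and> norm u = norm v \<and> u \<bullet> v = 0 \<and>
        Q = {a + s *\<^sub>R u + t *\<^sub>R v | s t. s \<in> {0..1} \<and> t \<in> {0..1}})"

definition is_gluing :: "real \<Rightarrow> plane set set \<Rightarrow> bool" where
  "is_gluing b G \<longleftrightarrow>
     finite G \<and>
     (\<forall>Q\<in>G. is_square Q) \<and>
     (\<forall>Q\<in>G. \<forall>R\<in>G. congruent_sets Q R) \<and>
     (\<forall>Q\<in>G. \<forall>R\<in>G. Q \<noteq> R \<longrightarrow> interior Q \<inter> interior R = {}) \<and>
     (\<forall>x. \<exists>y\<in>\<Union>G. equivalent_points b x y) \<and>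
     (\<forall>x\<in>interior (\<Union>G). \<forall>y\<in>interior (\<Union>G). equivalent_points b x y \<longrightarrow> x = y)"

end

theory Submission
  imports Defs
begin

text \<open>
  The equivalence classes are the orbits of the group of maps \<open>x \<mapsto> \<plusminus>x + 2c\<close> with \<open>c\<close> in the lattice,
  so the images of the squares of a gluing tile the plane by equal squares. At a point of an edge
  that is no corner, the square on the other side must have its edge on the same line; hence
  neighbours are parallel and the tiling consists of columns (or rows) of squares. Let \<open>u\<close> be the
  side of a square across the columns and \<open>v\<close> the side along them. Every translation \<open>2c\<close> has an
  integral \<open>u\<close>-coordinate, and if this coordinate is 0, then its \<open>v\<close>-coordinate is integral too.
  Let \<open>m\<close> and \<open>n\<close> be the \<open>u\<close>-coordinates of \<open>(2b, 0)\<close> and \<open>(0, 2)\<close>. Then \<open>(-2nb, 2m)\<close> has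
  \<open>u\<close>-coordinate 0, and integrality of its \<open>v\<close>-coordinate reads \<open>n\<^sup>2b\<^sup>2 + m\<^sup>2 = kb\<close>.

  Conversely, let \<open>b\<^sup>2 + r\<^sup>2 = 2pb\<close> and \<open>r = m/n\<close> in lowest terms. A rectangle spanned by
  \<open>2(-nb, m)\<close> and an orthogonal vector, of area \<open>2b\<close>, is a fundamental domain of the group. The
  ratio of its sides is rational, so it is cut into equal squares by a grid.
\<close>

section \<open>Squares in an orthogonal frame\<close>

definition frame :: "plane \<Rightarrow> plane \<Rightarrow> bool" where
  "frame u v \<longleftrightarrow> u \<noteq> 0 \<and> norm u = norm v \<and> u \<bullet> v = 0"

definition coord :: "plane \<Rightarrow> plane \<Rightarrow> real" where
  "coord u x = (x \<bullet> u) / (u \<bullet> u)"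

definition sq :: "plane \<Rightarrow> plane \<Rightarrow> plane \<Rightarrow> plane set" where
  "sq a u v = {a + s *\<^sub>R u + t *\<^sub>R v | s t. s \<in> {0..1} \<and> t \<in> {0..1}}"

lemma is_square_iff: "is_square Q \<longleftrightarrow> (\<exists>a u v. frame u v \<and> Q = sq a u v)"
  by (auto simp: is_square_def frame_def sq_def)

lemma coord_add: "coord u (x + y) = coord u x + coord u y"
  by (simp add: coord_def inner_add_left add_divide_distrib)

lemma coord_diff: "coord u (x - y) = coord u x - coord u y"
  by (simp add: coord_def inner_diff_left diff_divide_distrib)

lemma coord_minus: "coord u (- x) = - coord u x"
  by (simp add: coord_def)

lemma coord_scaleR: "coord u (c *\<^sub>R x) = c * coord u x"
  by (simp add: coord_def)

lemma coord_zero [simp]: "coord u 0 = 0"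
  by (simp add: coord_def)

lemmas coord_linear = coord_add coord_diff coord_minus coord_scaleR

lemma frame_swap: "frame u v \<Longrightarrow> frame v u"
  by (auto simp: frame_def inner_commute)

lemma frame_minus: "frame u v \<Longrightarrow> frame (- u) v"
  by (auto simp: frame_def)

lemma frame_coord [simp]:
  assumes "frame u v"
  shows "coord u u = 1" "coord v v = 1" "coord u v = 0" "coord v u = 0"
  using assms by (auto simp: frame_def coord_def inner_commute)

lemma frame_perp:
  assumes "frame u v"
  shows "v = (- snd u, fst u) \<or> v = (snd u, - fst u)"
proof -
  obtain u1 u2 v1 v2 where [simp]: "u = (u1, u2)" "v = (v1, v2)"
    by (cases u, cases v) auto
  have n: "u1\<^sup>2 + u2\<^sup>2 = v1\<^sup>2 + v2\<^sup>2" and o: "u1 * v1 + u2 * v2 = 0" and "u \<noteq> 0"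
    using assms by (auto simp: frame_def norm_Pair)
  then have pos: "u1\<^sup>2 + u2\<^sup>2 \<noteq> 0"
    by (auto simp: sum_power2_eq_zero_iff zero_prod_def)
  have "(v1 + u2) * (v1 - u2) * (u1\<^sup>2 + u2\<^sup>2) = 0"
    using n o by algebra
  then consider "v1 = - u2" | "v1 = u2"
    using pos by (auto simp: add_eq_0_iff)
  then show ?thesis
  proof cases
    case 1
    then have "v2\<^sup>2 = u1\<^sup>2" "u2 * (v2 - u1) = 0"
      using n o by (auto simp: algebra_simps)
    then show ?thesis using 1 by (auto simp: power2_eq_iff)
  next
    case 2
    then have "v2\<^sup>2 = u1\<^sup>2" "u2 * (v2 + u1) = 0"
      using n o by (auto simp: algebra_simps)
    then show ?thesis using 2 by (auto simp: power2_eq_iff)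
  qed
qed

lemma frame_decomp:
  assumes "frame u v"
  shows "x = coord u x *\<^sub>R u + coord v x *\<^sub>R v"
proof -
  define y where "y = x - coord u x *\<^sub>R u - coord v x *\<^sub>R v"
  have pos: "u \<bullet> u \<noteq> 0" "v \<bullet> v \<noteq> 0" and o: "u \<bullet> v = 0" "v \<bullet> u = 0"
    using assms by (auto simp: frame_def inner_commute)
  have "y \<bullet> u = 0" "y \<bullet> v = 0"
    unfolding y_def coord_def using pos o by (auto simp: inner_diff_left)
  then have "fst y * fst u + snd y * snd u = 0" "snd y * fst u - fst y * snd u = 0"
    using frame_perp[OF assms] by (cases u; cases y; force)+
  then have "fst y * (u \<bullet> u) = 0" "snd y * (u \<bullet> u) = 0"
    unfolding inner_prod_def inner_real_def by algebra+
  then have "fst y = 0" "snd y = 0" using pos by auto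
  then have "y = 0" by (simp add: prod_eq_iff)
  then show ?thesis by (simp add: y_def algebra_simps)
qed

lemma mem_sq:
  assumes "frame u v"
  shows "x \<in> sq a u v \<longleftrightarrow> 0 \<le> coord u (x - a) \<and> coord u (x - a) \<le> 1
    \<and> 0 \<le> coord v (x - a) \<and> coord v (x - a) \<le> 1"
proof
  assume "x \<in> sq a u v"
  then show "0 \<le> coord u (x - a) \<and> coord u (x - a) \<le> 1
    \<and> 0 \<le> coord v (x - a) \<and> coord v (x - a) \<le> 1"
    using assms by (auto simp: sq_def coord_linear)
next
  assume "0 \<le> coord u (x - a) \<and> coord u (x - a) \<le> 1
    \<and> 0 \<le> coord v (x - a) \<and> coord v (x - a) \<le> 1"
  moreover have "x = a + coord u (x - a) *\<^sub>R u + coord v (x - a) *\<^sub>R v"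
    using frame_decomp[OF assms, of "x - a"] by (simp add: algebra_simps)
  ultimately show "x \<in> sq a u v"
    unfolding sq_def by fastforce
qed

lemma frame_inner_pos: "frame u v \<Longrightarrow> u \<bullet> u > 0" "frame u v \<Longrightarrow> v \<bullet> v > 0"
  by (auto simp: frame_def)

lemma
  assumes "frame u v"
  shows interior_coord_ge: "interior {x. c \<le> coord u x} = {x. c < coord u x}"
    and interior_coord_le: "interior {x. coord u x \<le> c} = {x. coord u x < c}"
proof -
  have "{x. c \<le> coord u x} = {x. u \<bullet> x \<ge> c * (u \<bullet> u)}"
       "{x. c < coord u x} = {x. u \<bullet> x > c * (u \<bullet> u)}"
       "{x. coord u x \<le> c} = {x. u \<bullet> x \<le> c * (u \<bullet> u)}"
       "{x. coord u x < c} = {x. u \<bullet> x < c * (u \<bullet> u)}"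
    using frame_inner_pos(1)[OF assms] unfolding coord_def by (auto simp: field_simps inner_commute)
  moreover have "u \<noteq> 0" using assms by (simp add: frame_def)
  ultimately show "interior {x. c \<le> coord u x} = {x. c < coord u x}"
    "interior {x. coord u x \<le> c} = {x. coord u x < c}"
    by (simp_all add: interior_halfspace_ge interior_halfspace_le)
qed

lemma interior_box:
  assumes "frame u v"
  shows "interior {x. c \<le> coord u x \<and> coord u x \<le> d \<and> e \<le> coord v x \<and> coord v x \<le> f}
    = {x. c < coord u x \<and> coord u x < d \<and> e < coord v x \<and> coord v x < f}"
proof -
  have "{x. c \<le> coord u x \<and> coord u x \<le> d \<and> e \<le> coord v x \<and> coord v x \<le> f} =
    {x. c \<le> coord u x} \<inter> {x. coord u x \<le> d} \<inter> {x. e \<le> coord v x} \<inter> {x. coord v x \<le> f}"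
    by auto
  then show ?thesis
    using interior_coord_ge[OF assms] interior_coord_le[OF assms]
      interior_coord_ge[OF frame_swap[OF assms]] interior_coord_le[OF frame_swap[OF assms]]
    by auto
qed

lemma sq_eq_box:
  assumes "frame u v"
  shows "sq a u v = {x. coord u a \<le> coord u x \<and> coord u x \<le> coord u a + 1
    \<and> coord v a \<le> coord v x \<and> coord v x \<le> coord v a + 1}"
  unfolding set_eq_iff mem_Collect_eq mem_sq[OF assms] by (auto simp: coord_diff)

lemma interior_sq:
  assumes "frame u v"
  shows "interior (sq a u v) = {x. coord u a < coord u x \<and> coord u x < coord u a + 1
    \<and> coord v a < coord v x \<and> coord v x < coord v a + 1}"
  unfolding sq_eq_box[OF assms] by (rule interior_box[OF assms])

lemma sq_swap: "sq a u v = sq a v u"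
  by (force simp: sq_def algebra_simps)

lemma sq_minus: "sq a (- u) v = sq (a - u) u v"
proof -
  have *: "sq a (- u) v \<subseteq> sq (a - u) u v" for a u v
  proof
    fix x assume "x \<in> sq a (- u) v"
    then obtain s t where "x = a + s *\<^sub>R (- u) + t *\<^sub>R v" "s \<in> {0..1}" "t \<in> {0..1}"
      by (auto simp: sq_def)
    then have "x = (a - u) + (1 - s) *\<^sub>R u + t *\<^sub>R v" "1 - s \<in> {0..1}" "t \<in> {0..1}"
      by (auto simp: algebra_simps)
    then show "x \<in> sq (a - u) u v" unfolding sq_def by blast
  qed
  show ?thesis using *[of a u v] *[of "a - u" "- u" v] by auto
qed

lemma image_sq:
  shows "(\<lambda>x. x + d) ` sq a u v = sq (a + d) u v"
    and "(\<lambda>x. d - x) ` sq a u v = sq (d - a) (- u) (- v)"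
  unfolding sq_def by (force simp: algebra_simps image_iff)+

lemma compact_sq: "compact (sq a u v)"
proof -
  have "sq a u v = (\<lambda>(s, t). a + s *\<^sub>R u + t *\<^sub>R v) ` ({0..1} \<times> {0..1})"
    unfolding sq_def by (auto simp: image_iff Bex_def) blast+
  moreover have "continuous_on ({0..1} \<times> {0..1}) (\<lambda>(s, t). a + s *\<^sub>R u + t *\<^sub>R v)"
    unfolding case_prod_beta by (intro continuous_intros)
  ultimately show ?thesis
    by (simp add: compact_continuous_image compact_Times)
qed

lemma congruent_sq_norm_le:
  assumes "frame u v" "frame u' v'" "congruent_sets (sq a u v) (sq a' u' v')"
  shows "norm u \<le> norm u'"
proof -
  have diag: "(norm (s *\<^sub>R u + t *\<^sub>R v))\<^sup>2 = (s\<^sup>2 + t\<^sup>2) * (norm u)\<^sup>2" if "frame u v" for s t u v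
  proof -
    have "u \<bullet> u = v \<bullet> v" "u \<bullet> v = 0" "v \<bullet> u = 0"
      using that by (simp_all add: frame_def norm_eq inner_commute)
    then show ?thesis
      unfolding power2_norm_eq_inner
      by (simp add: inner_add_left inner_add_right power2_eq_square distrib_right mult.assoc)
  qed
  obtain f where f: "\<And>x y. dist (f x) (f y) = dist x y" "f ` sq a u v = sq a' u' v'"
    using assms(3) by (auto simp: congruent_sets_def)
  have "a \<in> sq a u v" "a + u + v \<in> sq a u v"
    using assms(1) by (simp_all add: mem_sq coord_linear)
  then have "f a \<in> sq a' u' v'" "f (a + u + v) \<in> sq a' u' v'"
    using f(2) by auto
  then obtain s t s' t' where st: "f a = a' + s *\<^sub>R u' + t *\<^sub>R v'" "f (a + u + v) = a' + s' *\<^sub>R u' + t' *\<^sub>R v'"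
    "s \<in> {0..1}" "t \<in> {0..1}" "s' \<in> {0..1}" "t' \<in> {0..1}"
    by (auto simp: sq_def)
  have "2 * (norm u)\<^sup>2 = (norm (1 *\<^sub>R u + 1 *\<^sub>R v))\<^sup>2"
    using diag[OF assms(1), of 1 1] by simp
  also have "\<dots> = (dist (a + u + v) a)\<^sup>2" by (simp add: dist_norm add.assoc)
  also have "\<dots> = (dist (f (a + u + v)) (f a))\<^sup>2" by (simp add: f(1))
  also have "\<dots> = (norm ((s' - s) *\<^sub>R u' + (t' - t) *\<^sub>R v'))\<^sup>2"
    unfolding st dist_norm by (simp add: algebra_simps)
  also have "\<dots> = ((s' - s)\<^sup>2 + (t' - t)\<^sup>2) * (norm u')\<^sup>2" by (rule diag[OF assms(2)])
  also have "\<dots> \<le> 2 * (norm u')\<^sup>2"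
  proof (rule mult_right_mono)
    have "(s' - s)\<^sup>2 \<le> 1" "(t' - t)\<^sup>2 \<le> 1"
      using st by (auto simp: abs_square_le_1 abs_le_iff)
    then show "(s' - s)\<^sup>2 + (t' - t)\<^sup>2 \<le> 2" by simp
  qed simp
  finally show ?thesis by (simp add: power2_le_iff_abs_le)
qed

section \<open>Equivalent points\<close>

lemma rect_lattice_add: "x \<in> rect_lattice b \<Longrightarrow> y \<in> rect_lattice b \<Longrightarrow> x + y \<in> rect_lattice b"
  unfolding rect_lattice_def
  by (auto simp: distrib_right[symmetric] simp flip: of_int_add)

lemma rect_lattice_minus: "x \<in> rect_lattice b \<Longrightarrow> - x \<in> rect_lattice b"
  unfolding rect_lattice_def by (auto simp flip: of_int_minus mult_minus_left)

lemma rect_lattice_0: "0 \<in> rect_lattice b"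
  unfolding rect_lattice_def by (auto simp: zero_prod_def intro: exI[of _ 0])

lemma rect_lattice_diff: "x \<in> rect_lattice b \<Longrightarrow> y \<in> rect_lattice b \<Longrightarrow> x - y \<in> rect_lattice b"
  using rect_lattice_add[of x b "- y"] rect_lattice_minus[of y b] by simp

lemma equivalent_points_iff:
  "equivalent_points b x y \<longleftrightarrow>
    (\<exists>c\<in>rect_lattice b. y = x + 2 *\<^sub>R c \<or> y = 2 *\<^sub>R c - x)"
proof
  have "\<exists>c\<in>rect_lattice b. fold point_reflection cs x = x + 2 *\<^sub>R c \<or>
      fold point_reflection cs x = 2 *\<^sub>R c - x" if "set cs \<subseteq> rect_lattice b" for cs
    using that
  proof (induction cs rule: rev_induct)
    case Nil
    then show ?case using rect_lattice_0 by force
  next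
    case (snoc d cs)
    then obtain c where c: "c \<in> rect_lattice b" "d \<in> rect_lattice b" and
      "fold point_reflection cs x = x + 2 *\<^sub>R c \<or> fold point_reflection cs x = 2 *\<^sub>R c - x"
      by auto
    then have "fold point_reflection (cs @ [d]) x = 2 *\<^sub>R (d - c) - x \<or>
        fold point_reflection (cs @ [d]) x = x + 2 *\<^sub>R (d - c)"
      by (auto simp: point_reflection_def algebra_simps)
    then show ?case using c rect_lattice_diff by blast
  qed
  then show "equivalent_points b x y \<Longrightarrow>
    \<exists>c\<in>rect_lattice b. y = x + 2 *\<^sub>R c \<or> y = 2 *\<^sub>R c - x"
    unfolding equivalent_points_def by blast
next
  assume "\<exists>c\<in>rect_lattice b. y = x + 2 *\<^sub>R c \<or> y = 2 *\<^sub>R c - x"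
  then obtain c where c: "c \<in> rect_lattice b" "y = x + 2 *\<^sub>R c \<or> y = 2 *\<^sub>R c - x" by auto
  from c(2) show "equivalent_points b x y"
  proof
    assume "y = x + 2 *\<^sub>R c"
    then show ?thesis unfolding equivalent_points_def
      using c(1) rect_lattice_0 by (intro exI[of _ "[0, c]"]) (auto simp: point_reflection_def)
  next
    assume "y = 2 *\<^sub>R c - x"
    then show ?thesis unfolding equivalent_points_def
      using c(1) by (intro exI[of _ "[c]"]) (auto simp: point_reflection_def)
  qed
qed

section \<open>Packings by parallel squares\<close>

text \<open>
  \<open>P\<close> stands for the lower left corners of parallel unit squares. On each side, a square has one
  aligned neighbour (\<open>t = 0\<close>) or two neighbours shifted by \<open>t\<close> and \<open>t - 1\<close>.
\<close>

locale bricks =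
  fixes P :: "(real \<times> real) set"
  assumes sep: "\<lbrakk>(x, y) \<in> P; (x', y') \<in> P; \<bar>x - x'\<bar> < 1; \<bar>y - y'\<bar> < 1\<rbrakk> \<Longrightarrow> x = x' \<and> y = y'"
    and right: "(x, y) \<in> P \<Longrightarrow> \<exists>t. 0 \<le> t \<and> t < 1 \<and> (x + 1, y + t) \<in> P \<and> (t = 0 \<or> (x + 1, y + t - 1) \<in> P)"
    and left: "(x, y) \<in> P \<Longrightarrow> \<exists>t. 0 \<le> t \<and> t < 1 \<and> (x - 1, y + t) \<in> P \<and> (t = 0 \<or> (x - 1, y + t - 1) \<in> P)"
    and up: "(x, y) \<in> P \<Longrightarrow> \<exists>t. 0 \<le> t \<and> t < 1 \<and> (x + t, y + 1) \<in> P \<and> (t = 0 \<or> (x + t - 1, y + 1) \<in> P)"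
    and down: "(x, y) \<in> P \<Longrightarrow> \<exists>t. 0 \<le> t \<and> t < 1 \<and> (x + t, y - 1) \<in> P \<and> (t = 0 \<or> (x + t - 1, y - 1) \<in> P)"
begin

lemma bricks_swap: "bricks {(x, y). (y, x) \<in> P}"
proof unfold_locales
  fix x y x' y' :: real
  assume "(x, y) \<in> {(x, y). (y, x) \<in> P}" "(x', y') \<in> {(x, y). (y, x) \<in> P}"
    "\<bar>x - x'\<bar> < 1" "\<bar>y - y'\<bar> < 1"
  then show "x = x' \<and> y = y'"
    using sep[of y x y' x'] by auto
qed (use right left up down in auto)

lemma bricks_reflect: "bricks {(x, y). (- x, y) \<in> P}"
proof unfold_locales
  fix x y x' y' :: real
  assume "(x, y) \<in> {(x, y). (- x, y) \<in> P}" "(x', y') \<in> {(x, y). (- x, y) \<in> P}"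
    "\<bar>x - x'\<bar> < 1" "\<bar>y - y'\<bar> < 1"
  then show "x = x' \<and> y = y'"
    using sep[of "- x" y "- x'" y'] by auto
next
  fix x y :: real
  assume xy: "(x, y) \<in> {(x, y). (- x, y) \<in> P}"
  show "\<exists>t. 0 \<le> t \<and> t < 1 \<and> (x + 1, y + t) \<in> {(x, y). (- x, y) \<in> P} \<and>
      (t = 0 \<or> (x + 1, y + t - 1) \<in> {(x, y). (- x, y) \<in> P})"
    using left[of "- x" y] xy by auto
  show "\<exists>t. 0 \<le> t \<and> t < 1 \<and> (x - 1, y + t) \<in> {(x, y). (- x, y) \<in> P} \<and>
      (t = 0 \<or> (x - 1, y + t - 1) \<in> {(x, y). (- x, y) \<in> P})"
    using right[of "- x" y] xy by (auto simp: algebra_simps)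
  have rev: "\<exists>t. 0 \<le> t \<and> t < 1 \<and> (- (x + t), z) \<in> P \<and> (t = 0 \<or> (- (x + t - 1), z) \<in> P)"
    if ex: "\<exists>t. 0 \<le> t \<and> t < 1 \<and> (- x + t, z) \<in> P \<and> (t = 0 \<or> (- x + t - 1, z) \<in> P)" for z
  proof -
    obtain t where t: "0 \<le> t" "t < 1" "(- x + t, z) \<in> P" "t = 0 \<or> (- x + t - 1, z) \<in> P"
      using ex by auto
    show ?thesis
      using t by (intro exI[of _ "if t = 0 then 0 else 1 - t"]) (auto simp: algebra_simps)
  qed
  show "\<exists>t. 0 \<le> t \<and> t < 1 \<and> (x + t, y + 1) \<in> {(x, y). (- x, y) \<in> P} \<and>
      (t = 0 \<or> (x + t - 1, y + 1) \<in> {(x, y). (- x, y) \<in> P})"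
    using rev[of "y + 1"] up[of "- x" y] xy by auto
  show "\<exists>t. 0 \<le> t \<and> t < 1 \<and> (x + t, y - 1) \<in> {(x, y). (- x, y) \<in> P} \<and>
      (t = 0 \<or> (x + t - 1, y - 1) \<in> {(x, y). (- x, y) \<in> P})"
    using rev[of "y - 1"] down[of "- x" y] xy by auto
qed

lemma shifted_up:
  assumes "(x, y) \<in> P" "(x + 1, y + t) \<in> P" "0 < t" "t < 1"
  shows "(x, y + 1) \<in> P \<and> (x + 1, y + 1 + t) \<in> P"
proof -
  obtain t' where t': "0 \<le> t'" "t' < 1" "(x + t', y + 1) \<in> P"
    using up[OF assms(1)] by auto
  have "t' = 0"
    using sep[OF t'(3) assms(2)] t' assms(3,4) by (cases "t' = 0") auto
  then have 1: "(x, y + 1) \<in> P" using t' by simp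
  obtain t'' where t'': "0 \<le> t''" "t'' < 1" "(x + 1, y + 1 + t'') \<in> P"
    "t'' = 0 \<or> (x + 1, y + 1 + t'' - 1) \<in> P"
    using right[OF 1] by auto
  have "t'' \<noteq> 0" using sep[OF t''(3) assms(2)] assms by auto
  then have "t'' = t" using sep[of "x + 1" "y + 1 + t'' - 1" "x + 1" "y + t"] t'' assms by auto
  then show ?thesis using 1 t'' by simp
qed

lemma shifted_down:
  assumes "(x, y) \<in> P" "(x + 1, y + t) \<in> P" "0 < t" "t < 1"
  shows "(x, y - 1) \<in> P \<and> (x + 1, y - 1 + t) \<in> P"
proof -
  obtain t'' where t'': "0 \<le> t''" "t'' < 1" "(x + 1, y + t'') \<in> P"
    "t'' = 0 \<or> (x + 1, y + t'' - 1) \<in> P"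
    using right[OF assms(1)] by auto
  have "t'' = t" using sep[OF t''(3) assms(2)] t'' assms by auto
  then have 1: "(x + 1, y - 1 + t) \<in> P" using t'' assms by (auto simp: algebra_simps)
  obtain t' where t': "0 \<le> t'" "t' < 1" "(x + t', y - 1) \<in> P"
    using down[OF assms(1)] by auto
  have "t' = 0"
    using sep[OF t'(3) 1] t' assms(3,4) by (cases "t' = 0") auto
  then show ?thesis using t' 1 by simp
qed

lemma shifted_all:
  assumes "(x, y) \<in> P" "(x + 1, y + t) \<in> P" "0 < t" "t < 1"
  shows "(x, y + of_int j) \<in> P \<and> (x + 1, y + of_int j + t) \<in> P"
proof (induction j rule: int_induct[where k = 0])
  case base
  then show ?case using assms by simp
next
  case (step1 i)
  then show ?case using shifted_up[of x "y + of_int i" t] assms by (auto simp: algebra_simps)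
next
  case (step2 i)
  then show ?case using shifted_down[of x "y + of_int i" t] assms by (auto simp: algebra_simps)
qed

lemma column_right:
  assumes col: "\<And>j::int. (x, y + of_int j) \<in> P"
  shows "\<exists>z. \<forall>j::int. (x + 1, z + of_int j) \<in> P"
proof (cases "\<exists>j t. 0 < t \<and> t < 1 \<and> (x + 1, y + of_int j + t) \<in> P")
  case True
  then obtain j :: int and t where t: "0 < t" "t < 1" "(x + 1, y + of_int j + t) \<in> P" by auto
  show ?thesis
    using shifted_all[OF col t(3,1,2)] by (intro exI[of _ "y + of_int j + t"]) (simp add: ac_simps)
next
  case False
  have "(x + 1, y + of_int j) \<in> P" for j :: int
    using right[OF col[of j]] False by (metis add.right_neutral order_le_less)
  then show ?thesis by auto
qed

lemma column_left:
  assumes "\<And>j::int. (x, y + of_int j) \<in> P"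
  shows "\<exists>z. \<forall>j::int. (x - 1, z + of_int j) \<in> P"
  using bricks.column_right[OF bricks_reflect, of "- x" y] assms by simp

lemma columns:
  assumes "\<And>j::int. (x, y + of_int j) \<in> P"
  shows "\<exists>z. \<forall>j::int. (x + of_int i, z + of_int j) \<in> P"
proof (induction i rule: int_induct[where k = 0])
  case base
  then show ?case using assms by auto
next
  case (step1 i)
  then show ?case using column_right[of "x + of_int i"] by (auto simp: algebra_simps)
next
  case (step2 i)
  then show ?case using column_left[of "x + of_int i"] by (auto simp: algebra_simps)
qed

lemma column_structure:
  assumes col: "\<And>j::int. (x, y + of_int j) \<in> P" and P: "(x', y') \<in> P"
  shows "x' - x \<in> \<int>" "x' = x \<Longrightarrow> y' - y \<in> \<int>"
proof -
  have near: "\<bar>r - of_int (round r)\<bar> < 1" for r :: real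
    using of_int_round_abs_le[of r] by linarith
  obtain z where z: "\<And>j::int. (x + of_int (round (x' - x)), z + of_int j) \<in> P"
    using columns[OF col] by blast
  have "x' = x + of_int (round (x' - x))"
    using sep[OF P z[of "round (y' - z)"]] near[of "x' - x"] near[of "y' - z"]
    by (simp add: algebra_simps)
  then show "x' - x \<in> \<int>" by (metis Ints_of_int add_diff_cancel_left')
  assume "x' = x"
  then have "y' = y + of_int (round (y' - y))"
    using sep[OF P col[of "round (y' - y)"]] near[of "y' - y"]
    by (simp add: algebra_simps)
  then show "y' - y \<in> \<int>" by (metis Ints_of_int add_diff_cancel_left')
qed

lemma unshifted_row:
  assumes "\<And>x y t. (x, y) \<in> P \<Longrightarrow> 0 < t \<Longrightarrow> t < 1 \<Longrightarrow> (x + 1, y + t) \<notin> P" "(x, y) \<in> P"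
  shows "(x + of_int j, y) \<in> P"
proof (induction j rule: int_induct[where k = 0])
  case base
  then show ?case using assms by simp
next
  case (step1 i)
  obtain t where t: "0 \<le> t" "t < 1" "(x + of_int i + 1, y + t) \<in> P" using right[OF step1(2)] by auto
  then have "t = 0" using assms(1)[OF step1(2), of t] by force
  then show ?case using t by (simp add: algebra_simps)
next
  case (step2 i)
  obtain t where t: "0 \<le> t" "t < 1" "(x + of_int i - 1, y + t) \<in> P"
    "t = 0 \<or> (x + of_int i - 1, y + t - 1) \<in> P" using left[OF step2(2)] by auto
  have "t = 0"
  proof (rule ccontr)
    assume "t \<noteq> 0"
    then show False
      using assms(1)[of "x + of_int i - 1" "y + t - 1" "1 - t"] t step2(2) by auto
  qed
  then show ?case using t by (simp add: algebra_simps)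
qed

lemma differences_integral:
  assumes "P \<noteq> {}"
  obtains x y where "(x, y) \<in> P"
    "\<forall>(x', y')\<in>P. x' - x \<in> \<int> \<and> (x' = x \<longrightarrow> y' - y \<in> \<int>)"
  | x y where "(x, y) \<in> P"
    "\<forall>(x', y')\<in>P. y' - y \<in> \<int> \<and> (y' = y \<longrightarrow> x' - x \<in> \<int>)"
proof (cases "\<exists>x y t. (x, y) \<in> P \<and> 0 < t \<and> t < 1 \<and> (x + 1, y + t) \<in> P")
  case True
  then obtain x y t where "(x, y) \<in> P" "0 < t" "t < 1" "(x + 1, y + t) \<in> P" by auto
  then have "\<And>j::int. (x, y + of_int j) \<in> P" "(x, y) \<in> P" using shifted_all by auto
  then show ?thesis using that(1) column_structure by fast
next
  case False
  obtain x y where xy: "(x, y) \<in> P" using assms by auto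
  have "\<And>j::int. (y, x + of_int j) \<in> {(x, y). (y, x) \<in> P}"
    using unshifted_row[OF _ xy] False by auto
  then have "\<forall>(x', y')\<in>P. y' - y \<in> \<int> \<and> (y' = y \<longrightarrow> x' - x \<in> \<int>)"
    using bricks.column_structure[OF bricks_swap, of y x] by fast
  then show ?thesis using that(2) xy by blast
qed

end

section \<open>Tilings of the plane by equal squares\<close>

lemma frame_coord_less:
  assumes "norm p = norm u" "u \<noteq> 0" "p \<noteq> u"
  shows "coord u p < 1"
proof -
  have "0 < (p - u) \<bullet> (p - u)" using assms by simp
  moreover have "p \<bullet> p = u \<bullet> u" using assms by (simp add: norm_eq)
  ultimately show ?thesis
    using assms by (simp add: coord_def inner_diff_left inner_diff_right inner_commute divide_less_eq)
qed

lemma abs_coord_le: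
  assumes "norm p = norm u"
  shows "\<bar>coord u p\<bar> \<le> 1"
proof (cases "u = 0")
  case False
  have "\<bar>p \<bullet> u\<bar> \<le> u \<bullet> u"
    using Cauchy_Schwarz_ineq2[of p u] assms by (simp add: power2_norm_eq_inner[symmetric] power2_eq_square)
  then show ?thesis using False by (simp add: coord_def divide_le_eq)
qed (simp add: coord_def)

lemma coord_commute:
  assumes "norm p = norm u"
  shows "coord p u = coord u p"
  using assms by (simp add: coord_def inner_commute norm_eq)

lemma adjacent_squares_parallel:
  assumes uv: "frame u v" and pq: "frame p q" and n: "norm p = norm u"
    and disj: "interior (sq a u v) \<inter> interior (sq c p q) = {}"
    and z: "z = a + u + y *\<^sub>R v" "0 < y" "y < 1" "z = c + w *\<^sub>R q" "0 < w" "w < 1"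
  shows "p = u"
proof (rule ccontr)
  assume "p \<noteq> u"
  have nn: "norm v = norm u" "norm q = norm u" "u \<noteq> 0" using uv pq n by (auto simp: frame_def)
  define e where "e = min (min w (1 - w)) (min y (1 - y)) / 2"
  have e: "0 < e" "e < w" "e < 1 - w" "e < y" "e < 1 - y"
    using z(2,3,5,6) by (auto simp: e_def min_def)
  have e2: "e < 1 / 2" using e by linarith
  have small: "\<bar>e * coord r s\<bar> \<le> e" if "norm r = norm s" for r s
    using abs_coord_le[of s r] that e(1) by (simp add: abs_mult)
  have less: "e * coord u p < e" using frame_coord_less[OF n nn(3) \<open>p \<noteq> u\<close>] e(1) by simp
  have cp: "coord p u = coord u p" using coord_commute[OF n] .
  \<comment> \<open>The direction \<open>p - u\<close> points into both squares if \<open>p \<noteq> u\<close>.\<close>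
  define z' where "z' = z + e *\<^sub>R (p - u)"
  have "coord u z' = coord u a + 1 + (e * coord u p - e)" "coord v z' = coord v a + y + e * coord v p"
    using uv by (simp_all add: z'_def z(1) coord_linear algebra_simps)
  then have "z' \<in> interior (sq a u v)"
    unfolding interior_sq[OF uv] mem_Collect_eq
    using less small[of u p] small[of v p] e e2 n nn by linarith
  moreover have "coord p z' = coord p c + (e - e * coord u p)" "coord q z' = coord q c + w - e * coord q u"
    using pq cp by (simp_all add: z'_def z(4) coord_linear algebra_simps)
  then have "z' \<in> interior (sq c p q)"
    unfolding interior_sq[OF pq] mem_Collect_eq
    using less small[of u p] small[of q u] e e2 n nn by linarith
  ultimately show False using disj by blast
qed

locale square_tiling =
  fixes T :: "plane set set" and l :: real
  assumes tile_square: "Q \<in> T \<Longrightarrow> \<exists>a u v. frame u v \<and> norm u = l \<and> Q = sq a u v"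
    and tiles_disjoint: "\<lbrakk>Q \<in> T; R \<in> T; Q \<noteq> R\<rbrakk> \<Longrightarrow> interior Q \<inter> interior R = {}"
    and tiles_cover: "\<exists>Q\<in>T. x \<in> Q"
    and locally_finite: "finite {Q \<in> T. Q \<inter> cball 0 r \<noteq> {}}"
begin

text \<open>The exceptional set \<open>E\<close> collects the heights at which the edge carries a vertex of another tile.\<close>

lemma generic_neighbour:
  assumes uv: "frame u v" "norm u = l" and Q: "sq a u v \<in> T"
  obtains E where "finite E"
    "\<And>y. \<lbrakk>0 < y; y < 1; y \<notin> E\<rbrakk> \<Longrightarrow> \<exists>t. y - 1 < t \<and> t < y \<and> sq (a + u + t *\<^sub>R v) u v \<in> T"
proof -
  define z where "z = (\<lambda>y. a + u + y *\<^sub>R v)"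
  define F where "F = {R \<in> T. R \<inter> cball 0 (norm a + 3 * l) \<noteq> {}} - {sq a u v}"
  have finF: "finite F" unfolding F_def using locally_finite by simp
  have v: "norm v = l" "v \<noteq> 0" using uv by (auto simp: frame_def)
  have "\<exists>c p q. frame p q \<and> norm p = l \<and> R = sq c p q" if "R \<in> F" for R
    using tile_square that by (auto simp: F_def)
  then obtain c p q where R: "\<And>R. R \<in> F \<Longrightarrow> frame (p R) (q R) \<and> norm (p R) = l \<and> R = sq (c R) (p R) (q R)"
    by metis
  define V where "V = (\<Union>R\<in>F. {c R, c R + p R, c R + q R, c R + p R + q R})"
  have "finite V" unfolding V_def using finF by auto
  have "finite (z -` V)"
    by (rule finite_vimageI[OF \<open>finite V\<close>]) (auto simp: z_def inj_on_def v)
  moreover have "\<exists>t. y - 1 < t \<and> t < y \<and> sq (a + u + t *\<^sub>R v) u v \<in> T"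
    if y: "0 < y" "y < 1" "z y \<notin> V" for y
  proof -
    have "closed (\<Union>F)"
      using finF R compact_sq by (metis closed_Union compact_imp_closed)
    have "z y \<in> \<Union>F"
    proof (rule ccontr)
      assume "z y \<notin> \<Union>F"
      then obtain e where "0 < e" "ball (z y) e \<subseteq> - \<Union>F"
        using \<open>closed (\<Union>F)\<close> by (metis closed_def open_contains_ball ComplI)
      then have e: "0 < e" "ball (z y) e \<inter> \<Union>F = {}" by auto
      have "l > 0" using uv by (auto simp: frame_def)
      obtain d where d: "0 < d" "d < 1" "d < e / l"
        using field_lbound_gt_zero[of 1 "e / l"] e(1) \<open>l > 0\<close> by auto
      then have "d * l < e" using \<open>l > 0\<close> by (simp add: pos_less_divide_eq)
      let ?w = "z y + d *\<^sub>R u"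
      obtain R where R': "R \<in> T" "?w \<in> R" using tiles_cover by blast
      have "?w \<notin> sq a u v"
        using mem_sq[OF uv(1)] uv(1) d by (auto simp: z_def coord_linear)
      moreover have "norm ?w \<le> norm a + 3 * l"
      proof -
        have "norm ?w \<le> norm (a + u) + norm (y *\<^sub>R v) + norm (d *\<^sub>R u)"
          unfolding z_def by (meson norm_triangle_le order_refl add_mono)
        also have "\<dots> \<le> (norm a + norm u) + 1 * norm v + 1 * norm u"
          using y d by (intro add_mono norm_triangle_ineq) (auto intro!: mult_left_le_one_le)
        finally show ?thesis using uv v by simp
      qed
      ultimately have "R \<in> F" using R' unfolding F_def by auto
      moreover have "?w \<in> ball (z y) e"
        using \<open>d * l < e\<close> d uv by (simp add: dist_norm)
      ultimately show False using e R' by blast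
    qed
    then obtain R where RF: "R \<in> F" "z y \<in> R" by auto
    have RT: "R \<in> T" "interior (sq a u v) \<inter> interior R = {}"
      using RF tiles_disjoint[OF Q] by (auto simp: F_def)
    define c' p' q' where "c' = c R" and "p' = p R" and "q' = q R"
    have pq: "frame p' q'" "norm p' = l" "norm q' = l" and R': "R = sq c' p' q'"
      using R[OF RF(1)] by (auto simp: frame_def c'_def p'_def q'_def)
    obtain \<alpha> \<beta> where ab: "z y = c' + \<alpha> *\<^sub>R p' + \<beta> *\<^sub>R q'" "\<alpha> \<in> {0..1}" "\<beta> \<in> {0..1}"
      using RF(2) unfolding R' sq_def by blast
    have nV: "z y \<noteq> c'" "z y \<noteq> c' + p'" "z y \<noteq> c' + q'" "z y \<noteq> c' + p' + q'"
      using y RF(1) by (auto simp: V_def c'_def p'_def q'_def)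
    have nI: "z y \<notin> interior R"
    proof
      assume "z y \<in> interior R"
      moreover have "z y - d *\<^sub>R u \<in> interior (sq a u v)" if "0 < d" "d < 1" for d
        unfolding interior_sq[OF uv(1)] using uv(1) y that by (auto simp: z_def coord_linear)
      moreover obtain e where e: "0 < e" "ball (z y) e \<subseteq> interior R"
        using \<open>z y \<in> interior R\<close> open_contains_ball open_interior by blast
      moreover have "l > 0" using uv by (auto simp: frame_def)
      moreover obtain d where d: "0 < d" "d < 1" "d < e / l"
        using field_lbound_gt_zero[of 1 "e / l"] e(1) \<open>l > 0\<close> by auto
      moreover have "z y - d *\<^sub>R u \<in> ball (z y) e"
        using d uv \<open>l > 0\<close> by (simp add: dist_norm pos_less_divide_eq)
      ultimately show False using RT(2) by blast
    qed
    have "\<exists>c p q w. (frame p q \<and> norm p = l) \<and> R = sq c p q \<and> z y = c + w *\<^sub>R q \<and> 0 < w \<and> w < 1"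
    proof -
      have "\<alpha> \<notin> {0, 1} \<or> \<beta> \<notin> {0, 1}" using ab nV by auto
      moreover have "\<not> (0 < \<alpha> \<and> \<alpha> < 1 \<and> 0 < \<beta> \<and> \<beta> < 1)"
        using nI pq(1) unfolding R' by (auto simp: interior_sq ab(1) coord_linear)
      ultimately consider "\<alpha> = 0" "0 < \<beta>" "\<beta> < 1" | "\<alpha> = 1" "0 < \<beta>" "\<beta> < 1"
        | "\<beta> = 0" "0 < \<alpha>" "\<alpha> < 1" | "\<beta> = 1" "0 < \<alpha>" "\<alpha> < 1"
        using ab(2,3) by fastforce
      then show ?thesis
      proof cases
        case 1
        then show ?thesis using pq R' ab(1)
          by (intro exI[of _ c'] exI[of _ p'] exI[of _ q'] exI[of _ \<beta>]) simp
      next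
        case 2
        have "R = sq (c' + p') (- p') q'" by (simp add: R' sq_minus)
        then show ?thesis using 2 pq ab(1) frame_minus[OF pq(1)]
          by (intro exI[of _ "c' + p'"] exI[of _ "- p'"] exI[of _ q'] exI[of _ \<beta>]) simp
      next
        case 3
        have "R = sq c' q' p'" by (subst sq_swap) (rule R')
        then show ?thesis using 3 pq ab(1) frame_swap[OF pq(1)]
          by (intro exI[of _ c'] exI[of _ q'] exI[of _ p'] exI[of _ \<alpha>]) simp
      next
        case 4
        have "R = sq (c' + q') (- q') p'" by (simp add: R' sq_minus sq_swap[of c' p' q'])
        then show ?thesis using 4 pq ab(1) frame_minus[OF frame_swap[OF pq(1)]]
          by (intro exI[of _ "c' + q'"] exI[of _ "- q'"] exI[of _ p'] exI[of _ \<alpha>]) simp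
      qed
    qed
    then obtain c p q w where w: "frame p q" "norm p = l" "R = sq c p q"
      "z y = c + w *\<^sub>R q" "0 < w" "w < 1" by blast
    have "p = u"
      using adjacent_squares_parallel[OF uv(1) w(1) _ _ _ y(1,2) w(4-6)] w(2,3) uv(2) RT(2) z_def by auto
    then consider "q = v" | "q = - v"
      using frame_perp[OF uv(1)] frame_perp[OF w(1)] by (auto simp: prod_eq_iff)
    then show ?thesis
    proof cases
      case 1
      then have "c = a + u + (y - w) *\<^sub>R v" using w(4) by (simp add: z_def algebra_simps)
      then show ?thesis using w RT(1) 1 \<open>p = u\<close> by (intro exI[of _ "y - w"]) auto
    next
      case 2
      have "R = sq (c - v) u v"
        using w(3) 2 \<open>p = u\<close> sq_minus[of c v u] by (simp add: sq_swap[of _ u])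
      moreover have "c - v = a + u + (y + w - 1) *\<^sub>R v" using w(4) 2 by (simp add: z_def algebra_simps)
      ultimately show ?thesis using w RT(1) by (intro exI[of _ "y + w - 1"]) auto
    qed
  qed
  ultimately show ?thesis using that[of "z -` V"] by auto
qed

lemma parallel_tiles_apart:
  assumes uv: "frame u v" and T: "sq a u v \<in> T" "sq a' u v \<in> T"
    and less: "\<bar>coord u (a - a')\<bar> < 1" "\<bar>coord v (a - a')\<bar> < 1"
  shows "a = a'"
proof (rule ccontr)
  assume "a \<noteq> a'"
  then have "a - a' \<noteq> 0" by simp
  have ne: "sq a u v \<noteq> sq a' u v"
  proof
    assume eq: "sq a u v = sq a' u v"
    have "a \<in> sq a u v" "a' \<in> sq a' u v" using mem_sq[OF uv] by (auto simp: coord_linear)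
    then have "a \<in> sq a' u v" "a' \<in> sq a u v" using eq by auto
    then have "coord u (a - a') = 0" "coord v (a - a') = 0"
      using mem_sq[OF uv] by (auto simp: coord_linear)
    then show False using frame_decomp[OF uv, of "a - a'"] \<open>a - a' \<noteq> 0\<close> by simp
  qed
  define m where "m = (1 / 2) *\<^sub>R (a + a') + (1 / 2) *\<^sub>R u + (1 / 2) *\<^sub>R v"
  have "m \<in> interior (sq a u v)" "m \<in> interior (sq a' u v)"
    using less uv unfolding interior_sq[OF uv] m_def by (auto simp: coord_linear abs_less_iff field_simps)
  then show False using tiles_disjoint[OF T ne] by blast
qed

lemma neighbours:
  assumes uv: "frame u v" "norm u = l" and Q: "sq a u v \<in> T"
  shows "\<exists>t. 0 \<le> t \<and> t < 1 \<and> sq (a + u + t *\<^sub>R v) u v \<in> T \<and>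
    (t = 0 \<or> sq (a + u + (t - 1) *\<^sub>R v) u v \<in> T)"
proof -
  define D where "D = {t. sq (a + u + t *\<^sub>R v) u v \<in> T}"
  obtain E where E: "finite E" "\<And>y. \<lbrakk>0 < y; y < 1; y \<notin> E\<rbrakk> \<Longrightarrow> \<exists>t. y - 1 < t \<and> t < y \<and> t \<in> D"
    using generic_neighbour[OF assms] unfolding D_def by (metis mem_Collect_eq)
  have near: "\<exists>y t. c < y \<and> y < d \<and> y - 1 < t \<and> t < y \<and> t \<in> D" if "0 \<le> c" "c < d" "d \<le> 1" for c d
  proof -
    have "infinite ({c<..<d} - E)" using that E(1) by (simp add: infinite_Ioo)
    then have "{c<..<d} - E \<noteq> {}" by (metis finite.emptyI)
    then obtain y where "y \<in> {c<..<d} - E" by blast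
    then show ?thesis using E(2)[of y] that by auto
  qed
  have apart: "t + 1 \<le> t'" if "t \<in> D" "t' \<in> D" "t < t'" for t t'
  proof (rule ccontr)
    assume "\<not> ?thesis"
    then have "a + u + t *\<^sub>R v = a + u + t' *\<^sub>R v"
      using that uv(1) by (intro parallel_tiles_apart[OF uv(1)]) (auto simp: D_def coord_linear)
    then show False using that uv(1) by (auto simp: frame_def)
  qed
  have pos: "\<exists>t. 0 \<le> t \<and> t < 1 \<and> t \<in> D"
  proof (rule ccontr)
    assume no: "\<not> ?thesis"
    obtain y t where t: "y - 1 < t" "t < y" "t \<in> D" "0 < y" "y < 1" using near[of 0 1] by auto
    then have "t < 0" using no by (meson not_le less_trans)
    obtain y' t' where t': "t + 1 < y'" "y' < 1" "y' - 1 < t'" "t' < y'" "t' \<in> D"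
      using near[of "t + 1" 1] t \<open>t < 0\<close> by auto
    then have "t + 1 \<le> t'" using apart[OF t(3) t'(5)] by linarith
    then show False using no t t' by force
  qed
  then obtain t where t: "0 \<le> t" "t < 1" "t \<in> D" by auto
  have "t - 1 \<in> D" if "t \<noteq> 0"
  proof (rule ccontr)
    assume no: "t - 1 \<notin> D"
    have "0 < t" using t(1) that by simp
    obtain y s where s: "0 < y" "y < t" "y - 1 < s" "s < y" "s \<in> D"
      using near[OF order_refl \<open>0 < t\<close> less_imp_le[OF t(2)]] by blast
    then have "s + 1 \<le> t" using apart[OF s(5) t(3)] by linarith
    moreover have "s \<noteq> t - 1" using no s by auto
    ultimately have "s + 1 < t" by linarith
    then obtain y' s' where s': "s + 1 < y'" "y' < t" "y' - 1 < s'" "s' < y'" "s' \<in> D"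
      using near[of "s + 1" t] t s by auto
    then have "s + 1 \<le> s'" "s' + 1 \<le> t" using apart[OF s(5) s'(5)] apart[OF s'(5) t(3)] by linarith+
    then show False using s t by linarith
  qed
  then show ?thesis using t unfolding D_def by blast
qed

lemma bricks_corners:
  assumes uv: "frame u v" "norm u = l"
  shows "bricks {(x, y). sq (x *\<^sub>R u + y *\<^sub>R v) u v \<in> T}"
proof unfold_locales
  fix x y x' y' :: real
  assume P: "(x, y) \<in> {(x, y). sq (x *\<^sub>R u + y *\<^sub>R v) u v \<in> T}"
    "(x', y') \<in> {(x, y). sq (x *\<^sub>R u + y *\<^sub>R v) u v \<in> T}" and less: "\<bar>x - x'\<bar> < 1" "\<bar>y - y'\<bar> < 1"
  have "x *\<^sub>R u + y *\<^sub>R v = x' *\<^sub>R u + y' *\<^sub>R v"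
    using P less uv(1) by (intro parallel_tiles_apart[OF uv(1)]) (auto simp: coord_linear)
  then have "coord u (x *\<^sub>R u + y *\<^sub>R v) = coord u (x' *\<^sub>R u + y' *\<^sub>R v)"
    "coord v (x *\<^sub>R u + y *\<^sub>R v) = coord v (x' *\<^sub>R u + y' *\<^sub>R v)" by simp_all
  then show "x = x' \<and> y = y'" using uv(1) by (simp add: coord_linear)
next
  fix x y :: real
  let ?P = "{(x, y). sq (x *\<^sub>R u + y *\<^sub>R v) u v \<in> T}"
  let ?a = "x *\<^sub>R u + y *\<^sub>R v"
  assume "(x, y) \<in> ?P"
  then have Q: "sq ?a u v \<in> T" by simp
  show "\<exists>t. 0 \<le> t \<and> t < 1 \<and> (x + 1, y + t) \<in> ?P \<and> (t = 0 \<or> (x + 1, y + t - 1) \<in> ?P)"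
    using neighbours[OF uv Q] by (simp add: algebra_simps)
  have "sq (?a + u) (- u) v \<in> T" using Q by (simp add: sq_minus)
  then show "\<exists>t. 0 \<le> t \<and> t < 1 \<and> (x - 1, y + t) \<in> ?P \<and> (t = 0 \<or> (x - 1, y + t - 1) \<in> ?P)"
    using neighbours[OF frame_minus[OF uv(1)], of "?a + u"] uv by (simp add: algebra_simps sq_minus)
  have Q': "sq ?a v u \<in> T" and vu: "frame v u" "norm v = l"
    using Q uv by (auto simp: sq_swap[of _ v u] frame_def inner_commute)
  show "\<exists>t. 0 \<le> t \<and> t < 1 \<and> (x + t, y + 1) \<in> ?P \<and> (t = 0 \<or> (x + t - 1, y + 1) \<in> ?P)"
    using neighbours[OF vu Q'] by (simp add: algebra_simps sq_swap[of _ v u])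
  have "sq (?a + v) (- v) u \<in> T" using Q' by (simp add: sq_minus)
  then show "\<exists>t. 0 \<le> t \<and> t < 1 \<and> (x + t, y - 1) \<in> ?P \<and> (t = 0 \<or> (x + t - 1, y - 1) \<in> ?P)"
    using neighbours[OF frame_minus[OF vu(1)], of "?a + v"] vu
    by (simp add: algebra_simps sq_minus sq_swap[of _ v u])
qed

lemma translation_coords:
  assumes periodic: "\<And>Q d. \<lbrakk>Q \<in> T; d \<in> L\<rbrakk> \<Longrightarrow> (\<lambda>x. x + d) ` Q \<in> T"
  obtains u v where "frame u v" "\<And>d. d \<in> L \<Longrightarrow> coord u d \<in> \<int>"
    "\<And>d. \<lbrakk>d \<in> L; coord u d = 0\<rbrakk> \<Longrightarrow> coord v d \<in> \<int>"
proof -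
  obtain Q where "Q \<in> T" using tiles_cover by blast
  then obtain a u v where uv: "frame u v" "norm u = l" "sq a u v \<in> T"
    using tile_square by metis
  define P where "P = {(x, y). sq (x *\<^sub>R u + y *\<^sub>R v) u v \<in> T}"
  interpret bricks P unfolding P_def by (rule bricks_corners[OF uv(1,2)])
  have "(coord u a, coord v a) \<in> P"
    using uv(3) frame_decomp[OF uv(1), of a] by (simp add: P_def)
  then have "P \<noteq> {}" by auto
  have shift: "(x + coord u d, y + coord v d) \<in> P" if "(x, y) \<in> P" "d \<in> L" for x y d
  proof -
    have "sq (x *\<^sub>R u + y *\<^sub>R v + d) u v \<in> T"
      using that periodic[of "sq (x *\<^sub>R u + y *\<^sub>R v) u v" d] by (simp add: P_def image_sq)
    moreover have "x *\<^sub>R u + y *\<^sub>R v + d = (x + coord u d) *\<^sub>R u + (y + coord v d) *\<^sub>R v"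
      by (subst frame_decomp[OF uv(1), of d]) (simp add: algebra_simps)
    ultimately show ?thesis by (simp add: P_def)
  qed
  show ?thesis
  proof (rule differences_integral[OF \<open>P \<noteq> {}\<close>])
    fix x y assume xy: "(x, y) \<in> P" and
      all: "\<forall>(x', y')\<in>P. x' - x \<in> \<int> \<and> (x' = x \<longrightarrow> y' - y \<in> \<int>)"
    show ?thesis
    proof (rule that[OF uv(1)])
      fix d assume "d \<in> L"
      then have "(x + coord u d, y + coord v d) \<in> P" by (rule shift[OF xy])
      then have "coord u d \<in> \<int> \<and> (coord u d = 0 \<longrightarrow> coord v d \<in> \<int>)" using all by fastforce
      then show "coord u d \<in> \<int>" "coord u d = 0 \<Longrightarrow> coord v d \<in> \<int>" by auto
    qed
  next
    fix x y assume xy: "(x, y) \<in> P" and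
      all: "\<forall>(x', y')\<in>P. y' - y \<in> \<int> \<and> (y' = y \<longrightarrow> x' - x \<in> \<int>)"
    show ?thesis
    proof (rule that[OF frame_swap[OF uv(1)]])
      fix d assume "d \<in> L"
      then have "(x + coord u d, y + coord v d) \<in> P" by (rule shift[OF xy])
      then have "coord v d \<in> \<int> \<and> (coord v d = 0 \<longrightarrow> coord u d \<in> \<int>)" using all by fastforce
      then show "coord v d \<in> \<int>" "coord v d = 0 \<Longrightarrow> coord u d \<in> \<int>" by auto
    qed
  qed
qed

end

section \<open>The tiling unfolded from a gluing\<close>

lemma equivalent_points_iff_sign:
  "equivalent_points b x y \<longleftrightarrow>
    (\<exists>e\<in>{1, - 1}. \<exists>c\<in>rect_lattice b. y = e *\<^sub>R x + 2 *\<^sub>R c)"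
  unfolding equivalent_points_iff by (auto simp: algebra_simps)

lemma interior_similar_image:
  fixes d :: plane
  assumes "e \<noteq> 0"
  shows "interior ((\<lambda>x. e *\<^sub>R x + d) ` S) = (\<lambda>x. e *\<^sub>R x + d) ` interior S"
proof -
  have "interior ((*\<^sub>R) e ` S) = (*\<^sub>R) e ` interior S"
    using assms by (intro interior_injective_linear_image linear_scale_self) (auto simp: inj_on_def)
  then have "interior ((+) d ` (*\<^sub>R) e ` S) = (+) d ` (*\<^sub>R) e ` interior S"
    by (simp add: interior_translation)
  then show ?thesis by (simp add: image_image add.commute)
qed

lemma finite_rect_lattice_bounded:
  assumes "b > 0"
  shows "finite {c \<in> rect_lattice b. norm c \<le> K}"
proof (rule finite_subset)
  define k where "k = max \<lceil>K / b\<rceil> \<lceil>K\<rceil>"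
  show "{c \<in> rect_lattice b. norm c \<le> K} \<subseteq> (\<lambda>(m, n). (of_int m * b, of_int n)) ` ({- k..k} \<times> {- k..k})"
  proof
    fix c assume "c \<in> {c \<in> rect_lattice b. norm c \<le> K}"
    then obtain m n :: int where c: "c = (of_int m * b, of_int n)" "norm c \<le> K"
      by (auto simp: rect_lattice_def)
    then have "\<bar>of_int m\<bar> * b \<le> K" "\<bar>real_of_int n\<bar> \<le> K"
      using norm_fst_le[of "of_int m * b" "real_of_int n"] norm_snd_le[of "real_of_int n" "of_int m * b"] assms
      by (auto simp: abs_mult)
    then have "\<bar>of_int m\<bar> \<le> K / b" "\<bar>real_of_int n\<bar> \<le> K"
      using assms by (auto simp: pos_le_divide_eq)
    then have "\<bar>m\<bar> \<le> k" "\<bar>n\<bar> \<le> k" unfolding k_def by linarith+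
    then show "c \<in> (\<lambda>(m, n). (of_int m * b, of_int n)) ` ({- k..k} \<times> {- k..k})"
      using c by (auto simp: abs_le_iff intro!: image_eqI[of _ _ "(m, n)"])
  qed
qed auto

definition orbit :: "real \<Rightarrow> plane set set \<Rightarrow> plane set set" where
  "orbit b G = {(\<lambda>x. e *\<^sub>R x + 2 *\<^sub>R c) ` Q | e c Q. e \<in> {1, - 1} \<and> c \<in> rect_lattice b \<and> Q \<in> G}"

lemma orbitE:
  assumes "A \<in> orbit b G"
  obtains e c Q where "e \<in> {1, - 1}" "c \<in> rect_lattice b" "Q \<in> G" "A = (\<lambda>x. e *\<^sub>R x + 2 *\<^sub>R c) ` Q"
  using assms unfolding orbit_def by blast

lemma square_tiling_orbit:
  assumes b: "b > 0" and G: "is_gluing b G"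
  obtains l where "square_tiling (orbit b G) l"
proof -
  have fin: "finite G" and sqG: "\<And>Q. Q \<in> G \<Longrightarrow> \<exists>a u v. frame u v \<and> Q = sq a u v"
    and cong: "\<And>Q R. Q \<in> G \<Longrightarrow> R \<in> G \<Longrightarrow> congruent_sets Q R"
    and disj: "\<And>Q R. Q \<in> G \<Longrightarrow> R \<in> G \<Longrightarrow> Q \<noteq> R \<Longrightarrow> interior Q \<inter> interior R = {}"
    and cover: "\<And>x. \<exists>y\<in>\<Union>G. equivalent_points b x y"
    and inj: "\<And>x y. x \<in> interior (\<Union>G) \<Longrightarrow> y \<in> interior (\<Union>G) \<Longrightarrow> equivalent_points b x y \<Longrightarrow> x = y"
  proof -
    note G' = G[unfolded is_gluing_def is_square_iff]
    show "finite G" using G' by (rule conjunct1)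
    show "\<exists>a u v. frame u v \<and> Q = sq a u v" if "Q \<in> G" for Q
      using G'[THEN conjunct2, THEN conjunct1] that by (rule bspec)
    show "congruent_sets Q R" if "Q \<in> G" "R \<in> G" for Q R
      using G'[THEN conjunct2, THEN conjunct2, THEN conjunct1] that by simp
    show "interior Q \<inter> interior R = {}" if "Q \<in> G" "R \<in> G" "Q \<noteq> R" for Q R
      using G'[THEN conjunct2, THEN conjunct2, THEN conjunct2, THEN conjunct1] that by simp
    show "\<exists>y\<in>\<Union>G. equivalent_points b x y" for x
      using G'[THEN conjunct2, THEN conjunct2, THEN conjunct2, THEN conjunct2, THEN conjunct1] by (rule spec)
    show "x = y" if "x \<in> interior (\<Union>G)" "y \<in> interior (\<Union>G)" "equivalent_points b x y" for x y
      using G'[THEN conjunct2, THEN conjunct2, THEN conjunct2, THEN conjunct2, THEN conjunct2] that by simp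
  qed
  obtain Q0 where "Q0 \<in> G" using cover by blast
  then obtain a0 u0 v0 where Q0: "frame u0 v0" "sq a0 u0 v0 \<in> G" using sqG by blast
  have lattice_sign: "e *\<^sub>R c \<in> rect_lattice b" if "e \<in> {1, - 1}" "c \<in> rect_lattice b" for e c
    using that by (auto intro: rect_lattice_minus)
  have "square_tiling (orbit b G) (norm u0)"
  proof
    fix R assume "R \<in> orbit b G"
    then obtain e c Q where R: "e \<in> {1, - 1}" "Q \<in> G" "R = (\<lambda>x. e *\<^sub>R x + 2 *\<^sub>R c) ` Q"
      by (rule orbitE)
    obtain a u v where Q: "frame u v" "Q = sq a u v" using sqG R by blast
    have "norm u = norm u0"
      using congruent_sq_norm_le[OF Q(1) Q0(1)] congruent_sq_norm_le[OF Q0(1) Q(1)] cong R(2) Q(2) Q0(2)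
      by (metis order_antisym)
    moreover have "frame (- u) (- v)" using Q(1) by (simp add: frame_def)
    moreover have "(\<lambda>x. e *\<^sub>R x + 2 *\<^sub>R c) = (\<lambda>x. x + 2 *\<^sub>R c) \<or> (\<lambda>x. e *\<^sub>R x + 2 *\<^sub>R c) = (\<lambda>x. 2 *\<^sub>R c - x)"
      using R(1) by auto
    then have "R = sq (a + 2 *\<^sub>R c) u v \<or> R = sq (2 *\<^sub>R c - a) (- u) (- v)"
      unfolding R(3) Q(2) by (elim disjE) (simp_all only: image_sq simp_thms)
    ultimately show "\<exists>a u v. frame u v \<and> norm u = norm u0 \<and> R = sq a u v"
      using Q(1) by (metis norm_minus_cancel)
  next
    fix A B assume AB: "A \<in> orbit b G" "B \<in> orbit b G" and ne: "A \<noteq> B"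
    obtain e c Q where A: "e \<in> {1, - 1}" "c \<in> rect_lattice b" "Q \<in> G" "A = (\<lambda>x. e *\<^sub>R x + 2 *\<^sub>R c) ` Q"
      using AB(1) by (rule orbitE)
    obtain e' c' R where B: "e' \<in> {1, - 1}" "c' \<in> rect_lattice b" "R \<in> G" "B = (\<lambda>x. e' *\<^sub>R x + 2 *\<^sub>R c') ` R"
      using AB(2) by (rule orbitE)
    have e: "e \<noteq> 0" "e' \<noteq> 0" "e' * e' = 1" using A(1) B(1) by auto
    have same: "\<exists>x. x \<in> interior Q \<and> x \<in> interior R \<and> z = e *\<^sub>R x + 2 *\<^sub>R c \<and> z = e' *\<^sub>R x + 2 *\<^sub>R c'"
      if z: "z \<in> interior A \<inter> interior B" for z
    proof -
      obtain x y where xy: "x \<in> interior Q" "z = e *\<^sub>R x + 2 *\<^sub>R c" "y \<in> interior R" "z = e' *\<^sub>R y + 2 *\<^sub>R c'"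
        using z unfolding A(4) B(4) interior_similar_image[OF e(1)] interior_similar_image[OF e(2)] by blast
      have "x \<in> interior (\<Union>G)" "y \<in> interior (\<Union>G)"
        using xy A(3) B(3) interior_mono[of _ "\<Union>G"] by (meson Union_upper subsetD)+
      moreover have "y = (e' * e) *\<^sub>R x + 2 *\<^sub>R (e' *\<^sub>R (c - c'))"
      proof -
        have "e' *\<^sub>R y = e *\<^sub>R x + 2 *\<^sub>R (c - c')" using xy by (simp add: algebra_simps)
        then have "e' *\<^sub>R e' *\<^sub>R y = e' *\<^sub>R (e *\<^sub>R x + 2 *\<^sub>R (c - c'))" by simp
        then show ?thesis using e(3) by (simp add: algebra_simps)
      qed
      then have "equivalent_points b x y"
        unfolding equivalent_points_iff_sign using A B lattice_sign rect_lattice_diff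
        by (intro bexI[of _ "e' * e"] bexI[of _ "e' *\<^sub>R (c - c')"]) auto
      ultimately have "x = y" using inj by blast
      then show ?thesis using xy by metis
    qed
    show "interior A \<inter> interior B = {}"
    proof (rule ccontr)
      assume ne': "interior A \<inter> interior B \<noteq> {}"
      then obtain z0 where z0: "z0 \<in> interior A \<inter> interior B" by auto
      then have "Q = R" using same disj[OF A(3) B(3)] by blast
      have "e \<noteq> e'"
      proof
        assume "e = e'"
        then have "c = c'" using same[OF z0] by (metis add_left_cancel scaleR_cancel_left zero_neq_numeral)
        then show False using ne A(4) B(4) \<open>Q = R\<close> \<open>e = e'\<close> by simp
      qed
      then have "e' = - e" using A(1) B(1) by auto
      have "z = c + c'" if z: "z \<in> interior A \<inter> interior B" for z
      proof -
        obtain x where "z = e *\<^sub>R x + 2 *\<^sub>R c" "z = e' *\<^sub>R x + 2 *\<^sub>R c'" using same[OF z] by blast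
        then have "z + z = 2 *\<^sub>R (c + c')" using \<open>e' = - e\<close> by (simp add: algebra_simps)
        then show ?thesis by (simp flip: scaleR_2)
      qed
      then have "interior A \<inter> interior B = {c + c'}" using z0 by blast
      moreover have "open (interior A \<inter> interior B)" by auto
      ultimately show False by (metis not_open_singleton)
    qed
  next
    fix x
    obtain y Q where "y \<in> Q" "Q \<in> G" "equivalent_points b x y" using cover by blast
    then obtain e c where ec: "e \<in> {1, - 1}" "c \<in> rect_lattice b" "y = e *\<^sub>R x + 2 *\<^sub>R c"
      unfolding equivalent_points_iff_sign by blast
    then have "x = e *\<^sub>R y + 2 *\<^sub>R ((- e) *\<^sub>R c)" by (auto simp: algebra_simps)
    moreover have "(- e) *\<^sub>R c \<in> rect_lattice b" using ec by (intro lattice_sign) auto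
    ultimately show "\<exists>R\<in>orbit b G. x \<in> R"
      unfolding orbit_def using ec(1) \<open>y \<in> Q\<close> \<open>Q \<in> G\<close> by blast
  next
    fix r
    have "bounded (\<Union>G)" using fin sqG compact_sq compact_imp_bounded by (metis bounded_Union)
    then obtain M where M: "\<And>x Q. x \<in> Q \<Longrightarrow> Q \<in> G \<Longrightarrow> norm x \<le> M" by (auto simp: bounded_iff)
    show "finite {Q \<in> orbit b G. Q \<inter> cball 0 r \<noteq> {}}"
    proof (rule finite_subset[OF _ finite_imageI])
      show "{Q \<in> orbit b G. Q \<inter> cball 0 r \<noteq> {}} \<subseteq>
        (\<lambda>(e, c, Q). (\<lambda>x. e *\<^sub>R x + 2 *\<^sub>R c) ` Q) ` ({1, - 1} \<times> {c \<in> rect_lattice b. norm c \<le> M + r} \<times> G)"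
      proof
        fix A assume "A \<in> {Q \<in> orbit b G. Q \<inter> cball 0 r \<noteq> {}}"
        then have A': "A \<in> orbit b G" "A \<inter> cball 0 r \<noteq> {}" by simp_all
        obtain e c Q where A: "e \<in> {1, - 1}" "c \<in> rect_lattice b" "Q \<in> G" "A = (\<lambda>x. e *\<^sub>R x + 2 *\<^sub>R c) ` Q"
          using A'(1) by (rule orbitE)
        obtain x where x: "x \<in> Q" "norm (e *\<^sub>R x + 2 *\<^sub>R c) \<le> r"
          using A'(2) unfolding A(4) by auto
        have "norm (2 *\<^sub>R c) \<le> norm (e *\<^sub>R x + 2 *\<^sub>R c) + norm (e *\<^sub>R x)"
          using norm_triangle_ineq4[of "e *\<^sub>R x + 2 *\<^sub>R c" "e *\<^sub>R x"] by simp
        also have "norm (e *\<^sub>R x) = norm x" using A(1) by auto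
        finally have "2 * norm c \<le> r + M" using M[OF x(1) A(3)] x(2) by simp
        then have "norm c \<le> M + r" using norm_ge_zero[of c] by linarith
        then show "A \<in> (\<lambda>(e, c, Q). (\<lambda>x. e *\<^sub>R x + 2 *\<^sub>R c) ` Q) ` ({1, - 1} \<times> {c \<in> rect_lattice b. norm c \<le> M + r} \<times> G)"
          using A by (intro image_eqI[of _ _ "(e, c, Q)"]) auto
      qed
      show "finite ({1, - 1 :: real} \<times> {c \<in> rect_lattice b. norm c \<le> M + r} \<times> G)"
        using fin finite_rect_lattice_bounded[OF b] by auto
    qed
  qed
  then show ?thesis by (rule that)
qed

lemma orbit_periodic:
  assumes "A \<in> orbit b G" "d \<in> rect_lattice b"
  shows "(\<lambda>x. x + 2 *\<^sub>R d) ` A \<in> orbit b G"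
proof -
  obtain e c Q where A: "e \<in> {1, - 1}" "c \<in> rect_lattice b" "Q \<in> G" "A = (\<lambda>x. e *\<^sub>R x + 2 *\<^sub>R c) ` Q"
    using assms(1) by (rule orbitE)
  have "(\<lambda>x. x + 2 *\<^sub>R d) ` A = (\<lambda>x. e *\<^sub>R x + 2 *\<^sub>R (c + d)) ` Q"
    unfolding A(4) image_image by (simp add: algebra_simps)
  then show ?thesis
    unfolding orbit_def using A rect_lattice_add[OF A(2) assms(2)] by blast
qed

lemma gluing_quadratic:
  assumes b: "b > 0" and G: "is_gluing b G"
  obtains k m n :: int where "n \<noteq> 0 \<or> m \<noteq> 0" "(of_int n)\<^sup>2 * b\<^sup>2 + (of_int m)\<^sup>2 = of_int k * b"
proof -
  obtain l where "square_tiling (orbit b G) l" using square_tiling_orbit[OF assms] .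
  then interpret square_tiling "orbit b G" l .
  define L where "L = (*\<^sub>R) 2 ` rect_lattice b"
  have per: "(\<lambda>x. x + d) ` Q \<in> orbit b G" if "Q \<in> orbit b G" "d \<in> L" for Q d
    using orbit_periodic that by (auto simp: L_def)
  obtain u v where uv: "frame u v" and int: "\<And>d. d \<in> L \<Longrightarrow> coord u d \<in> \<int>"
    "\<And>d. \<lbrakk>d \<in> L; coord u d = 0\<rbrakk> \<Longrightarrow> coord v d \<in> \<int>"
    using translation_coords[OF per] by blast
  obtain u1 u2 where u: "u = (u1, u2)" by (cases u)
  define N where "N = u \<bullet> u"
  have "N > 0" using frame_inner_pos[OF uv] by (simp add: N_def)
  have vv: "v \<bullet> v = N" using uv by (simp add: frame_def N_def norm_eq)
  have L: "(2 * of_int i * b, 2 * of_int j) \<in> L" for i j :: int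
    unfolding L_def rect_lattice_def by force
  obtain m :: int where "coord u (2 * b, 0) = of_int m"
    using int(1)[OF L[of 1 0]] by (auto elim: Ints_cases)
  then have m: "2 * b * u1 = of_int m * N"
    using \<open>N > 0\<close> by (simp add: coord_def u[symmetric] N_def[symmetric] divide_eq_eq) (simp add: u)
  obtain n :: int where "coord u (0, 2) = of_int n"
    using int(1)[OF L[of 0 1]] by (auto elim: Ints_cases)
  then have n: "2 * u2 = of_int n * N"
    using \<open>N > 0\<close> by (simp add: coord_def u[symmetric] N_def[symmetric] divide_eq_eq) (simp add: u)
  have nz: "n \<noteq> 0 \<or> m \<noteq> 0"
    using m n b \<open>N > 0\<close> by (auto simp: N_def u)
  let ?d = "(2 * of_int (- n) * b, 2 * of_int m) :: plane"
  have "(2 * of_int (- n) * b) * u1 + 2 * of_int m * u2 = 0"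
    using m n by simp algebra
  then have "coord u ?d = 0" by (simp add: coord_def u)
  then obtain k :: int where "coord v ?d = of_int k"
    using int(2)[OF L[of "- n" m]] by (auto elim: Ints_cases)
  then have k: "?d \<bullet> v = of_int k * N"
    using \<open>N > 0\<close> by (simp add: coord_def vv divide_eq_eq)
  have "N * ((of_int n)\<^sup>2 * b\<^sup>2 + (of_int m)\<^sup>2) = N * (of_int k * b) \<or>
    N * ((of_int n)\<^sup>2 * b\<^sup>2 + (of_int m)\<^sup>2) = N * (of_int (- k) * b)"
    using frame_perp[OF uv]
  proof
    assume "v = (- snd u, fst u)"
    then have "2 * of_int n * b * u2 + 2 * of_int m * u1 = of_int k * N" using k by (simp add: u)
    then show ?thesis using m n by simp algebra
  next
    assume "v = (snd u, - fst u)"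
    then have "- 2 * of_int n * b * u2 - 2 * of_int m * u1 = of_int k * N" using k by (simp add: u)
    then show ?thesis using m n by simp algebra
  qed
  then have "(of_int n)\<^sup>2 * b\<^sup>2 + (of_int m)\<^sup>2 = of_int k * b \<or>
    (of_int n)\<^sup>2 * b\<^sup>2 + (of_int m)\<^sup>2 = of_int (- k) * b"
    using \<open>N > 0\<close> by (metis mult_cancel_left less_irrefl)
  then show ?thesis using that nz by blast
qed

lemma rational_form_of_quadratic:
  fixes k m n :: int
  assumes b: "b > 0" and nz: "n \<noteq> 0 \<or> m \<noteq> 0"
    and eq: "(of_int n)\<^sup>2 * b\<^sup>2 + (of_int m)\<^sup>2 = of_int k * b"
  shows "\<exists>p r :: real. p \<in> \<rat> \<and> r \<in> \<rat> \<and> p \<ge> r \<and> r \<ge> 0 \<and>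
       (b = p + sqrt (p\<^sup>2 - r\<^sup>2) \<or> b = p - sqrt (p\<^sup>2 - r\<^sup>2))"
proof (cases "n = 0")
  case True
  then have "k \<noteq> 0" using eq nz by auto
  then have "b = (of_int m)\<^sup>2 / of_int k" using eq True by (simp add: field_simps)
  then have "b / 2 \<in> \<rat>" by simp
  then show ?thesis using b by (intro exI[of _ "b / 2"] exI[of _ 0]) simp
next
  case False
  define p r :: real where "p = of_int k / (2 * (of_int n)\<^sup>2)" and "r = \<bar>of_int m / of_int n\<bar>"
  have quad: "b\<^sup>2 + r\<^sup>2 = 2 * p * b"
    using eq False by (simp add: p_def r_def field_simps)
  have "2 * p * b > 0" using quad b by (metis add_pos_nonneg zero_less_power zero_le_power2)
  then have "p > 0" using b by (simp add: zero_less_mult_iff)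
  have sq: "(b - p)\<^sup>2 = p\<^sup>2 - r\<^sup>2" using quad by algebra
  then have "r\<^sup>2 \<le> p\<^sup>2" by (metis diff_ge_0_iff_ge zero_le_power2)
  then have "r \<le> p" using \<open>p > 0\<close> by (simp add: power2_le_iff_abs_le r_def)
  moreover have "sqrt (p\<^sup>2 - r\<^sup>2) = \<bar>b - p\<bar>" unfolding sq[symmetric] by simp
  then have "b = p + sqrt (p\<^sup>2 - r\<^sup>2) \<or> b = p - sqrt (p\<^sup>2 - r\<^sup>2)" by auto
  moreover have "p \<in> \<rat>" "r \<in> \<rat>" "r \<ge> 0" by (simp_all add: p_def r_def)
  ultimately show ?thesis by blast
qed

section \<open>A gluing by a grid\<close>

lemma rect_lattice_scale: "c \<in> rect_lattice b \<Longrightarrow> of_int k *\<^sub>R c \<in> rect_lattice b"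
  unfolding rect_lattice_def by (auto simp: mult.assoc[symmetric] simp flip: of_int_mult)

lemma unit_interval_containing:
  assumes "0 \<le> x" "x \<le> real n" "n > 0"
  shows "\<exists>i<n. real i \<le> x \<and> x \<le> real i + 1"
proof (cases "x = real n")
  case True
  then show ?thesis using assms(3) by (intro exI[of _ "n - 1"]) auto
next
  case False
  then show ?thesis using assms by (intro exI[of _ "nat \<lfloor>x\<rfloor>"]) (auto, linarith+)
qed

lemma floor_mod_bounds:
  fixes x m :: real
  assumes "m > 0"
  shows "0 \<le> x - of_int \<lfloor>x / m\<rfloor> * m" "x - of_int \<lfloor>x / m\<rfloor> * m < m"
  using floor_divide_lower[OF assms, of x] floor_divide_upper[OF assms, of x]
  by (simp_all add: distrib_right)

lemma grid_gluing:
  fixes M N :: nat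
  assumes uv: "frame u v" and pos: "M > 0" "N > 0"
    and t: "c1 \<in> rect_lattice b" "2 *\<^sub>R c1 = real M *\<^sub>R u"
    and w: "c2 \<in> rect_lattice b" "coord v (2 *\<^sub>R c2) = 2 * real N"
    and height: "\<And>c. c \<in> rect_lattice b \<Longrightarrow> \<exists>k::int. coord v (2 *\<^sub>R c) = of_int k * (2 * real N)"
    and width: "\<And>c. \<lbrakk>c \<in> rect_lattice b; coord v (2 *\<^sub>R c) = 0\<rbrakk> \<Longrightarrow> \<exists>k::int. coord u (2 *\<^sub>R c) = of_int k * real M"
  shows "is_gluing b ((\<lambda>(i, j). sq (real i *\<^sub>R u + real j *\<^sub>R v) u v) ` ({..<M} \<times> {..<N}))"
    (is "is_gluing b ?G")
proof -
  define S where "S i j = sq (real i *\<^sub>R u + real j *\<^sub>R v) u v" for i j :: nat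
  have G: "?G = {S i j | i j. i < M \<and> j < N}" by (auto simp: S_def)
  have corner: "coord u (real i *\<^sub>R u + real j *\<^sub>R v) = real i"
    "coord v (real i *\<^sub>R u + real j *\<^sub>R v) = real j" for i j
    using uv by (simp_all add: coord_linear)
  have mem: "x \<in> S i j \<longleftrightarrow> real i \<le> coord u x \<and> coord u x \<le> real i + 1 \<and> real j \<le> coord v x \<and> coord v x \<le> real j + 1" for x i j
    unfolding S_def sq_eq_box[OF uv] corner by simp
  have int: "x \<in> interior (S i j) \<longleftrightarrow> real i < coord u x \<and> coord u x < real i + 1 \<and> real j < coord v x \<and> coord v x < real j + 1" for x i j
    unfolding S_def interior_sq[OF uv] corner by simp
  have union: "\<Union>?G = {x. 0 \<le> coord u x \<and> coord u x \<le> real M \<and> 0 \<le> coord v x \<and> coord v x \<le> real N}" (is "_ = ?R")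
  proof
    show "\<Union>?G \<subseteq> ?R"
    proof
      fix x assume "x \<in> \<Union>?G"
      then obtain i j where "i < M" "j < N" "x \<in> S i j" unfolding G by blast
      moreover from this have "real i + 1 \<le> real M" "real j + 1 \<le> real N" by linarith+
      ultimately show "x \<in> ?R" unfolding mem by force
    qed
    show "?R \<subseteq> \<Union>?G"
    proof
      fix x assume "x \<in> ?R"
      then obtain i j where "i < M" "j < N" "x \<in> S i j"
        using unit_interval_containing[of "coord u x" M] unit_interval_containing[of "coord v x" N] pos mem by auto
      then show "x \<in> \<Union>?G" unfolding G by blast
    qed
  qed
  have interior: "interior (\<Union>?G) = {x. 0 < coord u x \<and> coord u x < real M \<and> 0 < coord v x \<and> coord v x < real N}"
    unfolding union by (rule interior_box[OF uv])
  show ?thesis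
    unfolding is_gluing_def
  proof (intro conjI ballI impI allI)
    show "finite ?G" by simp
  next
    fix Q assume "Q \<in> ?G"
    then show "is_square Q" unfolding is_square_iff G S_def using uv by blast
  next
    fix Q R assume "Q \<in> ?G" "R \<in> ?G"
    then obtain a a' where Q: "Q = sq a u v" and R: "R = sq a' u v"
      unfolding G S_def by blast
    have "(\<lambda>x. x + (a' - a)) ` Q = R" unfolding Q R image_sq by simp
    then show "congruent_sets Q R"
      unfolding congruent_sets_def by (intro exI[of _ "\<lambda>x. x + (a' - a)"]) (simp add: dist_norm)
  next
    fix Q R assume "Q \<in> ?G" "R \<in> ?G" "Q \<noteq> R"
    then obtain i j i' j' where Q: "Q = S i j" and R: "R = S i' j'" unfolding G by blast
    show "interior Q \<inter> interior R = {}"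
    proof (rule ccontr)
      assume "interior Q \<inter> interior R \<noteq> {}"
      then obtain x where "x \<in> interior (S i j)" "x \<in> interior (S i' j')" unfolding Q R by blast
      then have "i = i'" "j = j'" unfolding int by linarith+
      then show False using \<open>Q \<noteq> R\<close> Q R by simp
    qed
  next
    fix x
    define k where "k = \<lfloor>coord v x / (2 * real N)\<rfloor>"
    define y where "y = x - of_int k *\<^sub>R (2 *\<^sub>R c2)"
    have "coord v y = coord v x - of_int k * (2 * real N)" 
      unfolding y_def coord_diff coord_scaleR[of v "of_int k"] w(2) ..
    then have vy: "0 \<le> coord v y" "coord v y < 2 * real N"
      using floor_mod_bounds[of "2 * real N" "coord v x"] pos by (simp_all add: k_def)
    have vw: "coord v (2 *\<^sub>R c2 - y) = 2 * real N - coord v y" by (simp only: coord_diff w(2))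
    have "\<exists>e\<in>{1, - 1}. \<exists>c\<in>rect_lattice b. 0 \<le> coord v (e *\<^sub>R x + 2 *\<^sub>R c) \<and> coord v (e *\<^sub>R x + 2 *\<^sub>R c) \<le> real N"
    proof (cases "coord v y \<le> real N")
      case True
      moreover have "y = 1 *\<^sub>R x + 2 *\<^sub>R (of_int (- k) *\<^sub>R c2)" by (simp add: y_def)
      ultimately show ?thesis using vy(1) rect_lattice_scale[OF w(1)] by (metis insertI1)
    next
      case False
      then have "0 \<le> coord v (2 *\<^sub>R c2 - y)" "coord v (2 *\<^sub>R c2 - y) \<le> real N"
        unfolding vw using vy by linarith+
      moreover have "2 *\<^sub>R c2 - y = (- 1) *\<^sub>R x + 2 *\<^sub>R (of_int (k + 1) *\<^sub>R c2)" by (simp add: y_def algebra_simps)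
      ultimately show ?thesis using rect_lattice_scale[OF w(1)] by (metis insertI1 insertI2)
    qed
    then obtain e c where ec: "e \<in> {1, - 1}" "c \<in> rect_lattice b" and
      v: "0 \<le> coord v (e *\<^sub>R x + 2 *\<^sub>R c)" "coord v (e *\<^sub>R x + 2 *\<^sub>R c) \<le> real N" by blast
    define z where "z = e *\<^sub>R x + 2 *\<^sub>R c"
    define h where "h = \<lfloor>coord u z / real M\<rfloor>"
    define z' where "z' = z - of_int h *\<^sub>R (2 *\<^sub>R c1)"
    have "coord u z' = coord u z - of_int h * real M" "coord v z' = coord v z"
      using uv by (simp_all add: z'_def t(2) coord_linear)
    then have "z' \<in> \<Union>?G"
      unfolding union using floor_mod_bounds[of "real M" "coord u z"] pos v by (simp add: h_def z_def)
    moreover have "z' = e *\<^sub>R x + 2 *\<^sub>R (c - of_int h *\<^sub>R c1)" by (simp add: z'_def z_def algebra_simps)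
    then have "equivalent_points b x z'"
      unfolding equivalent_points_iff_sign using ec t rect_lattice_diff rect_lattice_scale by blast
    ultimately show "\<exists>y\<in>\<Union>?G. equivalent_points b x y" by blast
  next
    fix x y assume x: "x \<in> interior (\<Union>?G)" and y: "y \<in> interior (\<Union>?G)" and eq: "equivalent_points b x y"
    obtain c where c: "c \<in> rect_lattice b" "y = x + 2 *\<^sub>R c \<or> y = 2 *\<^sub>R c - x"
      using eq by (auto simp: equivalent_points_iff)
    have small: "k = 0" if "\<bar>of_int k * d\<bar> < d" for k :: int and d :: real
    proof (rule ccontr)
      assume "k \<noteq> 0"
      then have "1 \<le> \<bar>real_of_int k\<bar>" by linarith
      then have "1 * \<bar>d\<bar> \<le> \<bar>real_of_int k\<bar> * \<bar>d\<bar>" by (intro mult_right_mono) auto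
      then show False using that unfolding abs_mult by linarith
    qed
    obtain k :: int where k: "coord v (2 *\<^sub>R c) = of_int k * (2 * real N)" using height[OF c(1)] by auto
    from c(2) show "x = y"
    proof
      assume "y = x + 2 *\<^sub>R c"
      then have d: "coord v (2 *\<^sub>R c) = coord v y - coord v x" "coord u (2 *\<^sub>R c) = coord u y - coord u x"
        by (simp_all add: coord_linear)
      have "\<bar>of_int k * (2 * real N)\<bar> < 2 * real N"
        using x y unfolding k[symmetric] d interior by (simp add: abs_less_iff)
      then have "k = 0" by (rule small)
      then have v0: "coord v (2 *\<^sub>R c) = 0" using k by simp
      then obtain h :: int where h: "coord u (2 *\<^sub>R c) = of_int h * real M" using width[OF c(1)] by auto
      have "\<bar>of_int h * real M\<bar> < real M"
        using x y unfolding h[symmetric] d interior by (simp add: abs_less_iff)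
      then have "h = 0" by (rule small)
      then have "2 *\<^sub>R c = 0" using frame_decomp[OF uv, of "2 *\<^sub>R c"] h v0 by (metis add_0 mult_zero_left of_int_0 scaleR_zero_left)
      then show "x = y" using \<open>y = x + 2 *\<^sub>R c\<close> by simp
    next
      assume "y = 2 *\<^sub>R c - x"
      then have d: "coord v (2 *\<^sub>R c) = coord v y + coord v x"
        by (simp add: coord_linear)
      then have pos': "0 < of_int k * (2 * real N)" "\<bar>of_int k * (2 * real N)\<bar> < 2 * real N"
        using x y unfolding k[symmetric] d interior by (simp_all add: abs_less_iff)
      then have "k = 0" by (intro small)
      then show ?thesis using pos' by simp
    qed
  qed
qed

lemma gluing_of_quadratic:
  assumes b: "b > 0" and pr: "p \<in> \<rat>" "r \<in> \<rat>" and eq: "b\<^sup>2 + r\<^sup>2 = 2 * p * b"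
  shows "\<exists>G. is_gluing b G"
proof -
  obtain m n :: nat where r: "n \<noteq> 0" "\<bar>r\<bar> = real m / real n" "coprime m n"
    using Rats_abs_nat_div_natE[OF pr(2)] by metis
  have r2: "r\<^sup>2 = (real m)\<^sup>2 / (real n)\<^sup>2" using r(2) by (metis power2_abs power_divide)
  have "2 * p * b > 0" using eq b by (metis add_pos_nonneg zero_less_power zero_le_power2)
  then have "p > 0" using b by (simp add: zero_less_mult_iff)
  have "2 * p * (real n)\<^sup>2 \<in> \<rat>" using pr(1) by simp
  then obtain A B :: nat where AB: "B \<noteq> 0" "\<bar>2 * p * (real n)\<^sup>2\<bar> = real A / real B"
    using Rats_abs_nat_div_natE by metis
  then have AB': "2 * p * (real n)\<^sup>2 = real A / real B" using \<open>p > 0\<close> by simp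
  have "A \<noteq> 0"
  proof
    assume "A = 0"
    then show False using AB' \<open>p > 0\<close> r(1) by simp
  qed
  define s where "s = (real n * b)\<^sup>2 + (real m)\<^sup>2"
  have "s = (real n)\<^sup>2 * (b\<^sup>2 + r\<^sup>2)" using r(1) by (simp add: s_def r2 field_simps power_mult_distrib)
  then have s: "s * real B = real A * b" using AB' AB(1) by (simp add: eq field_simps)
  have "s > 0" using b r(1) by (simp add: s_def add_pos_nonneg)
  define u v :: plane where "u = (1 / real A) *\<^sub>R (- (real n * b), real m)" and "v = (1 / real A) *\<^sub>R (real m, real n * b)"
  have uu: "u \<bullet> u = s / (real A)\<^sup>2" "v \<bullet> v = s / (real A)\<^sup>2"
    by (simp_all add: u_def v_def s_def power2_eq_square add_divide_distrib)
  have uv: "frame u v"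
    unfolding frame_def
  proof (intro conjI)
    show "u \<noteq> 0" using uu(1) \<open>s > 0\<close> \<open>A \<noteq> 0\<close> by auto
    show "norm u = norm v" using uu by (simp add: norm_eq)
    show "u \<bullet> v = 0" by (simp add: u_def v_def)
  qed
  have cu: "coord u (2 *\<^sub>R (of_int i * b, of_int j)) = 2 * real A * (of_int j * real m - of_int i * real n * b\<^sup>2) / s" for i j :: int
    unfolding coord_def uu using \<open>A \<noteq> 0\<close> \<open>s > 0\<close>
    by (simp add: u_def field_simps power2_eq_square)
  have cv: "coord v (2 *\<^sub>R (of_int i * b, of_int j)) = of_int (i * int m + j * int n) * (2 * real B)" for i j :: int
  proof -
    have "coord v (2 *\<^sub>R (of_int i * b, of_int j)) = 2 * (real A * b) * (of_int i * real m + of_int j * real n) / s"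
      unfolding coord_def uu using \<open>A \<noteq> 0\<close> \<open>s > 0\<close>
      by (simp add: v_def field_simps power2_eq_square)
    also have "\<dots> = of_int (i * int m + j * int n) * (2 * real B)"
      unfolding s[symmetric] using \<open>s > 0\<close> by (simp add: field_simps)
    finally show ?thesis .
  qed
  have cop: "coprime (int n) (int m)" using r(3) by (simp add: coprime_commute)
  obtain i j :: int where ij: "i * int m + j * int n = 1"
    using bezout_int[of "int m" "int n"] cop by (metis coprime_commute coprime_imp_gcd_eq_1)
  show ?thesis
  proof (rule exI, rule grid_gluing[OF uv, of "2 * A" B "(- (real n * b), real m)" b "(of_int i * b, of_int j)"])
    show "0 < 2 * A" "0 < B" using \<open>A \<noteq> 0\<close> AB(1) by auto
    show "(- (real n * b), real m) \<in> rect_lattice b"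
      unfolding rect_lattice_def mem_Collect_eq by (intro exI[of _ "- int n"] exI[of _ "int m"]) simp
    show "2 *\<^sub>R (- (real n * b), real m) = real (2 * A) *\<^sub>R u"
      using \<open>A \<noteq> 0\<close> by (simp add: u_def)
    show "(of_int i * b, of_int j) \<in> rect_lattice b" unfolding rect_lattice_def by blast
    show "coord v (2 *\<^sub>R (of_int i * b, of_int j)) = 2 * real B" unfolding cv ij by simp
  next
    fix c assume "c \<in> rect_lattice b"
    then obtain i j :: int where c: "c = (of_int i * b, of_int j)" by (auto simp: rect_lattice_def)
    show "\<exists>k::int. coord v (2 *\<^sub>R c) = of_int k * (2 * real B)" unfolding c cv by blast
    assume "coord v (2 *\<^sub>R c) = 0"
    then have 0: "i * int m + j * int n = 0" unfolding c cv using AB(1) by (simp only: mult_eq_0_iff of_int_eq_0_iff) simp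
    then have "int n dvd i * int m" by (metis add.commute add_eq_0_iff dvd_minus_iff dvd_triv_right)
    then have "int n dvd i" using cop by (simp add: coprime_dvd_mult_left_iff)
    then obtain k where i: "i = int n * k" ..
    then have "int n * (k * int m + j) = 0" using 0 by (simp add: algebra_simps)
    then have j: "j = - (k * int m)" using r(1) by simp
    have "coord u (2 *\<^sub>R c) = 2 * real A * (- of_int k * s) / s"
      unfolding c cu i j s_def by (simp add: power2_eq_square algebra_simps)
    also have "\<dots> = of_int (- k) * real (2 * A)" using \<open>s > 0\<close> by simp
    finally show "\<exists>k::int. coord u (2 *\<^sub>R c) = of_int k * real (2 * A)" by blast
  qed
qed

theorem theorem1:
  fixes b :: real
  assumes "b > 0"
  shows "(\<exists>G. is_gluing b G) \<longleftrightarrow>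
    (\<exists>p r :: real. p \<in> \<rat> \<and> r \<in> \<rat> \<and> p \<ge> r \<and> r \<ge> 0 \<and>
       (b = p + sqrt (p\<^sup>2 - r\<^sup>2) \<or> b = p - sqrt (p\<^sup>2 - r\<^sup>2)))"
proof
  assume "\<exists>G. is_gluing b G"
  then obtain G where "is_gluing b G" ..
  then obtain k m n :: int where "n \<noteq> 0 \<or> m \<noteq> 0"
    "(of_int n)\<^sup>2 * b\<^sup>2 + (of_int m)\<^sup>2 = of_int k * b"
    using gluing_quadratic assms by metis
  then show "\<exists>p r :: real. p \<in> \<rat> \<and> r \<in> \<rat> \<and> p \<ge> r \<and> r \<ge> 0 \<and>
       (b = p + sqrt (p\<^sup>2 - r\<^sup>2) \<or> b = p - sqrt (p\<^sup>2 - r\<^sup>2))"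
    by (rule rational_form_of_quadratic[OF assms])
next
  assume "\<exists>p r :: real. p \<in> \<rat> \<and> r \<in> \<rat> \<and> p \<ge> r \<and> r \<ge> 0 \<and>
       (b = p + sqrt (p\<^sup>2 - r\<^sup>2) \<or> b = p - sqrt (p\<^sup>2 - r\<^sup>2))"
  then obtain p r :: real where pr: "p \<in> \<rat>" "r \<in> \<rat>" "p \<ge> r" "r \<ge> 0"
    "b = p + sqrt (p\<^sup>2 - r\<^sup>2) \<or> b = p - sqrt (p\<^sup>2 - r\<^sup>2)" by blast
  have "p\<^sup>2 - r\<^sup>2 \<ge> 0" using pr(3,4) by (simp add: power_mono)
  moreover have "b - p = sqrt (p\<^sup>2 - r\<^sup>2) \<or> b - p = - sqrt (p\<^sup>2 - r\<^sup>2)" using pr(5) by linarith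
  ultimately have "(b - p)\<^sup>2 = p\<^sup>2 - r\<^sup>2" by auto
  then have "b\<^sup>2 + r\<^sup>2 = 2 * p * b" by algebra
  then show "\<exists>G. is_gluing b G" by (rule gluing_of_quadratic[OF assms pr(1,2)])
qed

end
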